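(* If $\hat{\mathcal{X}}_f$ is a robust control invariant set for the augmented system $z_{t+1}=\tilde f(z_t,u_t,w_{t+1})$, then the distributionally robust optimal control problem (DR-OCP) is recursively feasible. That is, for every horizon $N\in\mathbb{N}_{>0}$ and every $z\in\mathcal{Z}$: if the DR-OCP of horizon $N$ is feasible for $z$, then it is feasible for $z^+=\tilde f(z,\hat\kappa_N(z),v)$, for all $v\in W$.
   Context: System: $x_{t+1}=f(x_t,u_t,w_{t+1})$ with $x_t\in\mathbb{R}^{n_x}$, $u_t\in\mathbb{R}^{n_u}$, and $(w_t)$ a time-homogeneous Markov chain on $W=\{1,\dots,d\}$. $\Delta_d$ is the probability simplex in $\mathbb{R}^d$. Learning system: learner states $s_t\in\mathcal{S}\subseteq\mathbb{R}^{n_s}$ with update $s_{t+1}=\mathcal{L}(s_t,w_t,w_{t+1})$; confidence vectors $\beta_t\in\mathcal{I}=[0,1]^{n_\beta}$, $n_\beta=n_g+1$, with update $\beta_{t+1}=C(\beta_t)$; components of $\beta$ are denoted $\beta^{(0)}$ (for the cost) and $\beta^{(1)},\dots,\beta^{(n_g)}$ (for the constraints). Ambiguity sets $\mathcal{A}_{b}(s,w)\subseteq\Delta_d$ are convex subsets, for $s\in\mathcal{S}$, $w\in W$, $b\in[0,1]$. Augmented state $z=(x,s,\beta,w)\in\mathcal{Z}=\mathbb{R}^{n_x}\times\mathcal{S}\times\mathcal{I}\times W$ with dynamics $\tilde f(z,u,v)=(f(x,u,v),\mathcal{L}(s,w,v),C(\beta),v)$. Risk measures: for $\xi:W\to\overline{\mathbb{R}}$,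 $\rho_{s,w,b}[\xi(v)]=\max_{p\in\mathcal{A}_b(s,w)}\sum_{v\in W}p_v\xi(v)$, where the value is $+\infty$ as soon as $\xi(v)=+\infty$ for some $v\in W$. For $\hat\alpha\in[0,1]$, $\bar\rho^{\,\hat\alpha}_{s,w,b}[\xi(v)]=\max_{p\in\mathcal{A}_b(s,w)}\mathrm{AV@R}^p_{\hat\alpha}[\xi(v)]$, with $\mathrm{AV@R}^p_{\hat\alpha}[\xi(v)]=\min_{t\in\mathbb{R}}t+\frac1{\hat\alpha}\sum_v p_v\max\{\xi(v)-t,0\}$ if $\hat\alpha\ne0$, and $\max_{v\in W}\xi(v)$ if $\hat\alpha=0$. Feasible inputs: given constraint functions $g_i:\mathbb{R}^{n_x}\times\mathbb{R}^{n_u}\times W^2\to\mathbb{R}$ and parameters $\hat\alpha_i\in[0,1]$ (possibly chosen depending on $\beta^{(i)}$), $\hat{\mathcal{U}}(z)=\{u:\bar\rho^{\,\hat\alpha_i}_{s,w,\beta^{(i)}}[g_i(x,u,w,v)]\le0,\ i=1,\dots,n_g\}$. DR-OCP of horizon $N$: given a stage cost $\ell:\mathbb{R}^{n_x}\times\mathbb{R}^{n_u}\times W\to\mathbb{R}_+$ and a terminal cost $\hat V_f(x,s,\beta,w)=V_f(x,w)+\delta_{\hat{\mathcal{X}}_f}(x,s,\beta)$, with $V_f\ge 0$ real-valued and $\delta$ the characteristic function ($0$ on the set, $+\infty$ outside), one minimizes over policies $(\pi_k)_{k=0}^{N-1}$, with $u_k=\pi_k(z_k)\in\hat{\mathcal{U}}(z_k)$,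 $z_0=z$, $z_{k+1}=\tilde f(z_k,u_k,w_{k+1})$ for all mode realizations, the nested-risk sum of stage costs plus terminal cost. Equivalently, its optimal cost $\hat V_N$ is given by dynamic programming: $\hat V_0=\hat V_f$, $\hat V_k=\mathcal{T}\hat V_{k-1}$, where $$\mathcal{T}(\hat V)(z)=\min_{u\in\hat{\mathcal{U}}(z)}\ell(x,u,w)+\rho_{s,w,\beta^{(0)}}[\hat V(\tilde f(z,u,v))].$$ The DR-OCP of horizon $N$ is feasible for $z$ iff $z\in\hat{\mathcal{Z}}_N=\operatorname{dom}\hat V_N$, where $\hat{\mathcal{Z}}_0=\operatorname{dom}\hat V_f$ (identified with $\hat{\mathcal{X}}_f$) and $\hat{\mathcal{Z}}_k=\{z:\exists u\in\hat{\mathcal{U}}(z),\ \tilde f(z,u,v)\in\hat{\mathcal{Z}}_{k-1}\ \forall v\in W\}$. For $z\in\hat{\mathcal{Z}}_N$, the MPC law $\hat\kappa_N(z)$ is a minimizer in the definition of $\mathcal{T}(\hat V_{N-1})(z)$ (minimizers are assumed to exist). A set $\mathcal{R}\subseteq\mathcal{Z}$ is robust control invariant for $\tilde f$ if for all $z\in\mathcal{R}$ there exists $u\in\hat{\mathcal{U}}(z)$ such that $\tilde f(z,u,v)\in\mathcal{R}$ for all $v\in W$. Here $\hat{\mathcal{X}}_f$ is identified with the corresponding subset $\operatorname{dom}\hat V_f$ of $\mathcal{Z}$. *)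

theory Defs
  imports "HOL-Analysis.Analysis"
begin

text \<open>
  Maxima and minima are written as suprema and infima in \<^typ>\<open>ereal\<close>; in particular an infimum
  over an empty set of feasible inputs is \<open>\<infinity>\<close>.
\<close>

text \<open>
  The modes are the elements of a finite type \<open>'d\<close>.  Confidence vectors have the components
  \<open>0, \<dots>, n_g\<close> and are represented by functions on \<open>{0..n_g}\<close>, so that \<open>n_g = 0\<close> is allowed and
  the number of constraints is a value rather than a type.
\<close>

type_synonym ('nx, 'ns, 'd) aug_state = "(real^'nx) \<times> (real^'ns) \<times> (nat \<Rightarrow> real) \<times> 'd"

record ('nx, 'nu, 'ns, 'd) dr_ocp =
  dyn :: "real^'nx \<Rightarrow> real^'nu \<Rightarrow> 'd \<Rightarrow> real^'nx"
  learner_states :: "(real^'ns) set"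
  learner :: "real^'ns \<Rightarrow> 'd \<Rightarrow> 'd \<Rightarrow> real^'ns"
  num_constr :: nat
  conf_update :: "(nat \<Rightarrow> real) \<Rightarrow> (nat \<Rightarrow> real)"
  ambiguity :: "real \<Rightarrow> real^'ns \<Rightarrow> 'd \<Rightarrow> (real^'d) set"
  constr :: "nat \<Rightarrow> real^'nx \<Rightarrow> real^'nu \<Rightarrow> 'd \<Rightarrow> 'd \<Rightarrow> real"
  risk_level :: "nat \<Rightarrow> real \<Rightarrow> real"
  stage_cost :: "real^'nx \<Rightarrow> real^'nu \<Rightarrow> 'd \<Rightarrow> real"
  term_cost :: "real^'nx \<Rightarrow> 'd \<Rightarrow> real"
  term_set :: "((real^'nx) \<times> (real^'ns) \<times> (nat \<Rightarrow> real)) set"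

definition prob_simplex :: "(real^'d) set" where
  "prob_simplex = {p. (\<forall>v. 0 \<le> p $ v) \<and> (\<Sum>v\<in>UNIV. p $ v) = 1}"

definition conf_space ::
    "('nx::finite, 'nu::finite, 'ns::finite, 'd::finite) dr_ocp \<Rightarrow> (nat \<Rightarrow> real) set" where
  "conf_space P = {0..num_constr P} \<rightarrow>\<^sub>E {0..1}"

definition aug_space ::
    "('nx::finite, 'nu::finite, 'ns::finite, 'd::finite) dr_ocp
    \<Rightarrow> ('nx, 'ns, 'd) aug_state set" where
  "aug_space P = UNIV \<times> learner_states P \<times> conf_space P \<times> UNIV"

definition well_posed ::
    "('nx::finite, 'nu::finite, 'ns::finite, 'd::finite) dr_ocp \<Rightarrow> bool" where
  "well_posed P \<longleftrightarrow>
     (\<forall>s\<in>learner_states P. \<forall>w v. learner P s w v \<in> learner_states P) \<and>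
     (\<forall>\<beta>\<in>conf_space P. conf_update P \<beta> \<in> conf_space P) \<and>
     (\<forall>b\<in>{0..1}. \<forall>s\<in>learner_states P. \<forall>w.
        ambiguity P b s w \<subseteq> prob_simplex \<and> convex (ambiguity P b s w)) \<and>
     (\<forall>i\<in>{1..num_constr P}. \<forall>b\<in>{0..1}. risk_level P i b \<in> {0..1}) \<and>
     (\<forall>x u w. 0 \<le> stage_cost P x u w) \<and>
     (\<forall>x w. 0 \<le> term_cost P x w) \<and>
     term_set P \<subseteq> UNIV \<times> learner_states P \<times> conf_space P"

fun aug_dyn ::
    "('nx::finite, 'nu::finite, 'ns::finite, 'd::finite) dr_ocp
    \<Rightarrow> ('nx, 'ns, 'd) aug_state \<Rightarrow> real^'nu \<Rightarrow> 'd
    \<Rightarrow> ('nx, 'ns, 'd) aug_state" where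
  "aug_dyn P (x, s, \<beta>, w) u v = (dyn P x u v, learner P s w v, conf_update P \<beta>, v)"

text \<open>
  The case distinction matters: with \<open>0 * \<infinity> = 0\<close> in \<^typ>\<open>ereal\<close>, the sum alone would ignore
  infinite values of \<open>\<xi>\<close> at modes of probability zero.
\<close>

definition worst_case_expectation :: "(real^'d) set \<Rightarrow> ('d::finite \<Rightarrow> ereal) \<Rightarrow> ereal" where
  "worst_case_expectation A \<xi> =
     (if \<exists>v. \<xi> v = \<infinity> then \<infinity> else (SUP p\<in>A. \<Sum>v\<in>UNIV. ereal (p $ v) * \<xi> v))"

definition avar :: "real \<Rightarrow> real^'d \<Rightarrow> ('d::finite \<Rightarrow> ereal) \<Rightarrow> ereal" where
  "avar \<alpha> p \<xi> =
     (if \<alpha> \<noteq> 0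
      then (INF t::real. ereal t + ereal (1 / \<alpha>) * (\<Sum>v\<in>UNIV. ereal (p $ v) * max (\<xi> v - ereal t) 0))
      else Max (range \<xi>))"

definition worst_case_avar :: "(real^'d) set \<Rightarrow> real \<Rightarrow> ('d::finite \<Rightarrow> ereal) \<Rightarrow> ereal" where
  "worst_case_avar A \<alpha> \<xi> = (SUP p\<in>A. avar \<alpha> p \<xi>)"

fun feasible_inputs ::
    "('nx::finite, 'nu::finite, 'ns::finite, 'd::finite) dr_ocp \<Rightarrow> ('nx, 'ns, 'd) aug_state
    \<Rightarrow> (real^'nu) set" where
  "feasible_inputs P (x, s, \<beta>, w) =
     {u. \<forall>i\<in>{1..num_constr P}.
           worst_case_avar (ambiguity P (\<beta> i) s w) (risk_level P i (\<beta> i))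
             (\<lambda>v. ereal (constr P i x u w v)) \<le> 0}"

fun term_value ::
    "('nx::finite, 'nu::finite, 'ns::finite, 'd::finite) dr_ocp
    \<Rightarrow> ('nx, 'ns, 'd) aug_state \<Rightarrow> ereal" where
  "term_value P (x, s, \<beta>, w) =
     ereal (term_cost P x w) + (if (x, s, \<beta>) \<in> term_set P then 0 else \<infinity>)"

fun dp_objective ::
    "('nx::finite, 'nu::finite, 'ns::finite, 'd::finite) dr_ocp
    \<Rightarrow> (('nx, 'ns, 'd) aug_state \<Rightarrow> ereal)
    \<Rightarrow> ('nx, 'ns, 'd) aug_state \<Rightarrow> real^'nu \<Rightarrow> ereal" where
  "dp_objective P V (x, s, \<beta>, w) u =
     ereal (stage_cost P x u w)
       + worst_case_expectation (ambiguity P (\<beta> 0) s w) (\<lambda>v. V (aug_dyn P (x, s, \<beta>, w) u v))"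

definition dp_operator ::
    "('nx::finite, 'nu::finite, 'ns::finite, 'd::finite) dr_ocp
    \<Rightarrow> (('nx, 'ns, 'd) aug_state \<Rightarrow> ereal) \<Rightarrow> ('nx, 'ns, 'd) aug_state \<Rightarrow> ereal" where
  "dp_operator P V z = (INF u\<in>feasible_inputs P z. dp_objective P V z u)"

primrec opt_value ::
    "('nx::finite, 'nu::finite, 'ns::finite, 'd::finite) dr_ocp \<Rightarrow> nat
    \<Rightarrow> ('nx, 'ns, 'd) aug_state \<Rightarrow> ereal" where
  "opt_value P 0 = term_value P"
| "opt_value P (Suc k) = dp_operator P (opt_value P k)"

definition eff_dom ::
    "('nx::finite, 'nu::finite, 'ns::finite, 'd::finite) dr_ocp
    \<Rightarrow> (('nx, 'ns, 'd) aug_state \<Rightarrow> ereal)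
    \<Rightarrow> ('nx, 'ns, 'd) aug_state set" where
  "eff_dom P V = {z \<in> aug_space P. V z < \<infinity>}"

definition feasible ::
    "('nx::finite, 'nu::finite, 'ns::finite, 'd::finite) dr_ocp \<Rightarrow> nat
    \<Rightarrow> ('nx, 'ns, 'd) aug_state \<Rightarrow> bool" where
  "feasible P N z \<longleftrightarrow> z \<in> eff_dom P (opt_value P N)"

text \<open>For horizon \<open>N > 0\<close>; minimizers need not be unique, so any selection of them is an MPC law.\<close>

definition mpc_law ::
    "('nx::finite, 'nu::finite, 'ns::finite, 'd::finite) dr_ocp \<Rightarrow> nat
    \<Rightarrow> (('nx, 'ns, 'd) aug_state \<Rightarrow> real^'nu) \<Rightarrow> bool" where
  "mpc_law P N \<kappa> \<longleftrightarrow>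
     (\<forall>z. feasible P N z \<longrightarrow>
        is_arg_min (dp_objective P (opt_value P (N - 1)) z) (\<lambda>u. u \<in> feasible_inputs P z) (\<kappa> z))"

definition robust_control_invariant ::
    "('nx::finite, 'nu::finite, 'ns::finite, 'd::finite) dr_ocp
    \<Rightarrow> ('nx, 'ns, 'd) aug_state set \<Rightarrow> bool" where
  "robust_control_invariant P R \<longleftrightarrow>
     R \<subseteq> aug_space P \<and> (\<forall>z\<in>R. \<exists>u\<in>feasible_inputs P z. \<forall>v. aug_dyn P z u v \<in> R)"


text \<open>
  Sanity checks: the effective domains of the value functions are the terminal set (as a subset
  of the augmented space) and its iterated robust predecessor sets.
\<close>

lemma feasible_0:
  assumes "well_posed P"
  shows "feasible P 0 (x, s, \<beta>, w) \<longleftrightarrow> (x, s, \<beta>) \<in> term_set P"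
  using assms by (auto simp: feasible_def eff_dom_def aug_space_def well_posed_def)

lemma worst_case_expectation_finite_iff:
  assumes "A \<subseteq> prob_simplex"
  shows "worst_case_expectation A \<xi> < \<infinity> \<longleftrightarrow> (\<forall>v. \<xi> v < \<infinity>)"
proof (cases "\<exists>v. \<xi> v = \<infinity>")
  case True
  then show ?thesis by (auto simp: worst_case_expectation_def)
next
  case False
  define M where "M = max 0 (Max (range \<xi>))"
  have M: "\<xi> v \<le> M" for v by (auto simp: M_def le_max_iff_disj)
  have "Max (range \<xi>) \<in> range \<xi>" by (intro Max_in) auto
  then obtain v where "Max (range \<xi>) = \<xi> v" by (rule rangeE)
  with False have "M < \<infinity>" by (simp add: M_def max_def)
  have "(\<Sum>v\<in>UNIV. ereal (p $ v) * \<xi> v) \<le> M" if "p \<in> A" for p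
  proof -
    have p: "\<And>v. 0 \<le> p $ v" "(\<Sum>v\<in>UNIV. p $ v) = 1"
      using that assms by (auto simp: prob_simplex_def)
    have "(\<Sum>v\<in>UNIV. ereal (p $ v) * \<xi> v) \<le> (\<Sum>v\<in>UNIV. ereal (p $ v) * M)"
      by (intro sum_mono ereal_mult_left_mono M) (simp add: p)
    also have "\<dots> = (\<Sum>v\<in>UNIV. ereal (p $ v)) * M"
      by (intro sum_ereal_left_distrib [symmetric]) (simp add: p)
    also have "\<dots> = M" by (simp add: p one_ereal_def [symmetric])
    finally show ?thesis .
  qed
  then have "worst_case_expectation A \<xi> \<le> M"
    using False by (auto simp: worst_case_expectation_def intro: SUP_least)
  with \<open>M < \<infinity>\<close> False show ?thesis by (auto simp: less_top [symmetric] top_ereal_def)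
qed

lemma aug_dyn_closed:
  assumes "well_posed P" "z \<in> aug_space P"
  shows "aug_dyn P z u v \<in> aug_space P"
  using assms by (cases z) (auto simp: aug_space_def well_posed_def)

lemma dp_objective_finite_iff:
  assumes "well_posed P" "z \<in> aug_space P"
  shows "dp_objective P V z u < \<infinity> \<longleftrightarrow> (\<forall>v. aug_dyn P z u v \<in> eff_dom P V)"
proof -
  obtain x s \<beta> w where z: "z = (x, s, \<beta>, w)" by (cases z) auto
  have "\<beta> 0 \<in> {0..1}"
    using assms(2) by (auto simp: z aug_space_def conf_space_def PiE_def Pi_def)
  then have "ambiguity P (\<beta> 0) s w \<subseteq> prob_simplex"
    using assms by (auto simp: z aug_space_def well_posed_def)
  from worst_case_expectation_finite_iff [OF this] aug_dyn_closed [OF assms] show ?thesis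
    by (simp add: z eff_dom_def)
qed

lemma feasible_Suc:
  assumes "well_posed P"
  shows "feasible P (Suc k) z \<longleftrightarrow>
    z \<in> aug_space P \<and> (\<exists>u\<in>feasible_inputs P z. \<forall>v. feasible P k (aug_dyn P z u v))"
proof (cases "z \<in> aug_space P")
  case True
  have "feasible P (Suc k) z \<longleftrightarrow>
      (\<exists>u\<in>feasible_inputs P z. dp_objective P (opt_value P k) z u < \<infinity>)"
    using True by (simp only: feasible_def eff_dom_def dp_operator_def opt_value.simps
        mem_Collect_eq INF_less_iff simp_thms)
  with True show ?thesis
    by (simp only: dp_objective_finite_iff [OF assms True] feasible_def simp_thms)
next
  case False
  then show ?thesis by (simp add: feasible_def eff_dom_def)
qed

end

theory Submission
  imports Defs
begin

text \<open>
  Invariance of the terminal set makes the feasible sets increase with the horizon. A minimizer at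
  a feasible state has finite cost, so all its successors are feasible for horizon \<open>N - 1\<close>, hence
  for horizon \<open>N\<close>.
\<close>

text \<open>Invariance is exactly the inclusion of the horizon-0 feasible set in the horizon-1 one;
  taking robust predecessors is monotone and propagates it.\<close>

lemma feasible_Suc_mono:
  assumes "well_posed P" "robust_control_invariant P (eff_dom P (term_value P))"
    and "feasible P k z"
  shows "feasible P (Suc k) z"
  using assms(3)
proof (induction k arbitrary: z)
  case 0
  then have "z \<in> eff_dom P (term_value P)"
    by (simp add: feasible_def)
  with assms(2) show ?case
    unfolding feasible_Suc [OF assms(1)]
    by (auto simp: robust_control_invariant_def feasible_def)
next
  case (Suc k)
  \<comment> \<open>The input that witnesses horizon \<open>Suc k\<close> is kept; the induction
    hypothesis lifts each of its successors by one step.\<close>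
  then show ?case
    unfolding feasible_Suc [OF assms(1), of "Suc k"] feasible_Suc [OF assms(1), of k z]
    by blast
qed

lemma mpc_successor_feasible:
  assumes "well_posed P" "mpc_law P (Suc k) \<kappa>" "feasible P (Suc k) z"
  shows "feasible P k (aug_dyn P z (\<kappa> z) v)"
proof -
  let ?J = "dp_objective P (opt_value P k) z"
  obtain u where z: "z \<in> aug_space P" and u: "u \<in> feasible_inputs P z"
    and succ: "\<And>v. feasible P k (aug_dyn P z u v)"
    using assms(3) feasible_Suc [OF assms(1)] by blast
  have "is_arg_min ?J (\<lambda>u. u \<in> feasible_inputs P z) (\<kappa> z)"
    using assms(2,3) unfolding mpc_law_def diff_Suc_1 by blast
  with u have "?J (\<kappa> z) \<le> ?J u"
    by (auto simp: is_arg_min_def not_less)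
  also have "?J u < \<infinity>"
    using succ dp_objective_finite_iff [OF assms(1) z] by (auto simp: feasible_def)
  \<comment> \<open>Finite cost constrains every mode \<open>v\<close>, even one of probability
    zero, because \<open>worst_case_expectation\<close> is infinite once any successor value
    is.\<close>
  finally show ?thesis
    using dp_objective_finite_iff [OF assms(1) z] by (auto simp: feasible_def)
qed

theorem mainTheorem2:
  fixes P :: "('nx::finite, 'nu::finite, 'ns::finite, 'd::finite) dr_ocp"
  assumes "well_posed P"
    and "robust_control_invariant P (eff_dom P (term_value P))"
  shows "\<forall>N>0. \<forall>\<kappa>. mpc_law P N \<kappa> \<longrightarrow>
           (\<forall>z\<in>aug_space P. feasible P N z \<longrightarrow> (\<forall>v. feasible P N (aug_dyn P z (\<kappa> z) v)))"
proof (intro allI impI ballI)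
  fix N :: nat and \<kappa> z v
  assume "N > 0" "mpc_law P N \<kappa>" "feasible P N z"
  then obtain k where "N = Suc k" by (cases N) auto
  with \<open>mpc_law P N \<kappa>\<close> \<open>feasible P N z\<close> show "feasible P N (aug_dyn P z (\<kappa> z) v)"
    using feasible_Suc_mono [OF assms] mpc_successor_feasible [OF assms(1)] by blast
qed

end
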